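(* Let $u\ge0$ be real. Then (i) for all integers $m\ge2$, $|c_m(u)|\le 24\,m^{u/2}$; and (ii) for all integers $m\ge1$, $|c_m(u)|\le 6u\,m^{u/2+1}$.
   Context: For $w\in\mathbb C$ define $c_m(w)$, $m\ge1$, by the formal power series identity $\bigl(1+2\sum_{n\ge1}q^{n^2}\bigr)^w=\sum_{j\ge0}\binom wj2^j\bigl(\sum_{n\ge1}q^{n^2}\bigr)^j=1+\sum_{m\ge1}c_m(w)q^m$; equivalently $\theta(t)^w=1+\sum_{m\ge1}c_m(w)e^{-\pi mt}$ where $\theta(t)=\sum_{n\in\mathbb Z}e^{-\pi n^2t}$. *)

theory Defs
  imports Complex_Main "HOL-Computational_Algebra.Formal_Power_Series"
begin

text \<open>The formal power series \<open>\<Sum>n\<ge>1. q ^ (n\<^sup>2)\<close>; see \<open>squares_fps_sums\<close>.\<close>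

definition squares_fps :: "complex fps" where
  "squares_fps = Abs_fps (\<lambda>m. if \<exists>n\<ge>1. m = n ^ 2 then 1 else 0)"

text \<open>
  The power \<open>(1 + 2 * S) ^ w\<close> with \<open>S = squares_fps\<close> is the binomial series
  \<open>(1 + X) ^ w = \<Sum>j. (w gchoose j) * X ^ j\<close> composed with \<open>2 * S\<close>, which has
  constant term 0; see \<open>theta_power_fps_sums\<close>.
\<close>

definition theta_power_fps :: "complex \<Rightarrow> complex fps" where
  "theta_power_fps w = fps_binomial w oo (2 * squares_fps)"

definition theta_coeff :: "complex \<Rightarrow> nat \<Rightarrow> complex" where
  "theta_coeff w m = fps_nth (theta_power_fps w) m"

lemma theta_coeff_0: "theta_coeff w 0 = 1"
  by (simp add: theta_coeff_def theta_power_fps_def)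

lemma squares_fps_sums: "(\<lambda>n. fps_X ^ (Suc n ^ 2)) sums squares_fps"
  unfolding sums_def tendsto_fps_iff
proof (intro allI eventually_sequentiallyI)
  fix m N :: nat
  assume N: "m \<le> N"
  have "fps_nth (\<Sum>n<N. fps_X ^ (Suc n ^ 2)) m
          = (\<Sum>n<N. if m = Suc n ^ 2 then 1 else (0::complex))"
    by (simp add: fps_sum_nth)
  also have "\<dots> = (if \<exists>n\<ge>1. m = n ^ 2 then 1 else 0)"
  proof (cases "\<exists>n\<ge>1. m = n ^ 2")
    case True
    then obtain k where k: "m = Suc k ^ 2"
      by (metis One_nat_def Suc_le_D)
    have "Suc k \<le> m"
      unfolding k by (simp add: power2_eq_square)
    with N have "k < N" by simp
    have "m = Suc n ^ 2 \<longleftrightarrow> n = k" for n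
      unfolding k by (auto simp: power2_eq_iff_nonneg)
    with True \<open>k < N\<close> show ?thesis by simp
  next
    case False
    then have "m \<noteq> Suc n ^ 2" for n
      by (metis One_nat_def Suc_le_mono le0)
    with False show ?thesis by simp
  qed
  finally show "fps_nth (\<Sum>n<N. fps_X ^ (Suc n ^ 2)) m = fps_nth squares_fps m"
    by (simp add: squares_fps_def)
qed

lemma theta_power_fps_sums:
  "(\<lambda>j. fps_const ((w gchoose j) * 2 ^ j) * squares_fps ^ j) sums theta_power_fps w"
  unfolding sums_def tendsto_fps_iff
proof (intro allI eventually_sequentiallyI)
  fix m N :: nat
  assume N: "Suc m \<le> N"
  have S0: "fps_nth squares_fps 0 = 0"
    by (simp add: squares_fps_def)
  have two: "fps_nth ((2 * squares_fps) ^ j) m = 2 ^ j * fps_nth (squares_fps ^ j) m" for j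
  proof -
    have "(2 * squares_fps) ^ j = fps_const (2 ^ j) * squares_fps ^ j"
      by (simp only: power_mult_distrib numeral_fps_const fps_const_power)
    then show ?thesis by (simp only: fps_mult_left_const_nth)
  qed
  have "fps_nth (\<Sum>j<N. fps_const ((w gchoose j) * 2 ^ j) * squares_fps ^ j) m
          = (\<Sum>j<N. (w gchoose j) * 2 ^ j * fps_nth (squares_fps ^ j) m)"
    by (simp add: fps_sum_nth)
  also have "\<dots> = (\<Sum>j=0..m. (w gchoose j) * 2 ^ j * fps_nth (squares_fps ^ j) m)"
    using N S0 by (intro sum.mono_neutral_right) (auto simp: startsby_zero_power_prefix)
  also have "\<dots> = fps_nth (theta_power_fps w) m"
    by (simp only: theta_power_fps_def fps_compose_nth fps_binomial_nth two mult.assoc)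
  finally show "fps_nth (\<Sum>j<N. fps_const ((w gchoose j) * 2 ^ j) * squares_fps ^ j) m
                  = fps_nth (theta_power_fps w) m" .
qed

end

theory Submission
  imports Defs "HOL-Complex_Analysis.Complex_Analysis"
begin

text \<open>
  Splitting the double series for \<open>theta (\<plusminus> q\<^sup>2) ^ 2\<close> by parity gives
  \<open>theta q * theta (- q) = theta (- q\<^sup>2) ^ 2\<close> and \<open>theta q ^ 2 + theta (- q) ^ 2 = 2 * theta (q\<^sup>2) ^ 2\<close>.
  The first identity shows that \<open>theta\<close> has no zero in the unit disk, so \<open>theta ^ u\<close> is holomorphic there
  and bounded by \<open>theta r ^ u\<close> on \<open>\<bar>q\<bar> = r\<close>. The second reduces \<open>theta (24 powr (- x)) \<le> 1 / sqrt x\<close> for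
  \<open>0 < x \<le> 1/2\<close> to \<open>1/4 \<le> x \<le> 1/2\<close>, where convexity leaves finitely many numerical checks. Cauchy's
  inequality with \<open>r ^ m = 1/24\<close> then yields (i). Part (ii) follows from (i) if \<open>u * m \<ge> 4\<close>; otherwise
  Caratheodory's inequality \<open>\<bar>c\<^sub>m\<bar> r ^ m \<le> 2 * (theta r ^ u - 1)\<close> supplies the factor \<open>u\<close>.
\<close>

subsection \<open>Coefficients of holomorphic functions with bounded real part\<close>

text \<open>Cauchy's formula as a plain integral over \<open>{0..1}\<close>, where real parts and
  conjugates can be taken: the derivative of the circle is \<open>2 * pi * \<i>\<close> times the
  circle itself, which cancels one power in the denominator.\<close>

lemma has_integral_coefficient_circlepath:
  assumes "continuous_on (cball 0 r) f" "f holomorphic_on ball 0 r" "r > 0"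
  shows "((\<lambda>x. f (circlepath 0 r x) / circlepath 0 r x ^ m) has_integral (deriv ^^ m) f 0 / fact m) {0..1}"
proof -
  have "vector_derivative (circlepath 0 r) (at x) = 2 * pi * \<i> * circlepath 0 r x" for x
    unfolding vector_derivative_circlepath by (simp add: circlepath mult_ac)
  then have "((\<lambda>x. f (circlepath 0 r x) / circlepath 0 r x ^ Suc m * (2 * pi * \<i> * circlepath 0 r x))
      has_integral 2 * pi * \<i> / fact m * (deriv ^^ m) f 0) {0..1}"
    using Cauchy_has_contour_integral_higher_derivative_circlepath[OF assms(1,2), of 0 m] assms(3)
    by (simp add: has_contour_integral mult_ac)
  then have "((\<lambda>x. 1 / (2 * pi * \<i>) * (f (circlepath 0 r x) / circlepath 0 r x ^ Suc m * (2 * pi * \<i> * circlepath 0 r x)))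
      has_integral 1 / (2 * pi * \<i>) * (2 * pi * \<i> / fact m * (deriv ^^ m) f 0)) {0..1}"
    by (rule has_integral_mult_right)
  moreover have "circlepath 0 r x \<noteq> 0" for x
    using assms(3) by (simp add: circlepath)
  ultimately show ?thesis
    by (simp add: field_simps)
qed

text \<open>Every positive-order coefficient of the conjugate of \<open>f\<close> on the circle vanishes, so \<open>f\<close> may be
  replaced by \<open>2 * Re f - 2 * A\<close>, which has constant sign.\<close>

theorem norm_coefficient_le_of_Re_le:
  assumes cont: "continuous_on (cball 0 r) f" and holo: "f holomorphic_on ball 0 r" and r: "r > 0"
    and Re_le: "\<And>z. norm z = r \<Longrightarrow> Re (f z) \<le> A" and m: "m > 0"
  shows "norm ((deriv ^^ m) f 0 / fact m) \<le> 2 * (A - Re (f 0)) / r ^ m"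
proof -
  define c where "c = circlepath 0 r"
  have norm_c: "norm (c x) = r" for x
    using r by (simp add: c_def circlepath norm_mult)
  have c0: "c x \<noteq> 0" for x
    using norm_c[of x] r by auto
  have cnj_c: "cnj (c x) = r\<^sup>2 / c x" for x
    using complex_norm_square[of "c x"] c0[of x] by (simp add: norm_c field_simps)
  \<comment> \<open>Mean value of \<open>f z * z ^ m\<close>, which vanishes at 0 because
    \<open>m > 0\<close>. Conjugating and using \<open>cnj (c x) = r\<^sup>2 / c x\<close> turns
    this into the vanishing coefficient of \<open>cnj f\<close>.\<close>
  have "((\<lambda>x. f (c x) * c x ^ m / c x ^ 0) has_integral (deriv ^^ 0) (\<lambda>z. f z * z ^ m) 0 / fact 0) {0..1}"
    unfolding c_def using cont holo r
    by (intro has_integral_coefficient_circlepath continuous_intros holomorphic_intros) auto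
  then have "((\<lambda>x. cnj (f (c x) * c x ^ m)) has_integral cnj 0) {0..1}"
    using m by (subst o_def[symmetric, of cnj], subst has_integral_cnj) (simp add: zero_power)
  then have "((\<lambda>x. of_real (1 / r ^ (2 * m)) * (cnj (f (c x)) * (r\<^sup>2 / c x) ^ m))
      has_integral of_real (1 / r ^ (2 * m)) * 0) {0..1}"
    by (intro has_integral_mult_right) (simp add: cnj_c)
  then have conj: "((\<lambda>x. cnj (f (c x)) / c x ^ m) has_integral 0) {0..1}"
    using r by (simp add: power_divide power_mult)
  have coef: "((\<lambda>x. f (c x) / c x ^ m) has_integral (deriv ^^ m) f 0 / fact m) {0..1}"
    unfolding c_def by (rule has_integral_coefficient_circlepath[OF cont holo r])
  have const: "((\<lambda>x. 2 * A / c x ^ m) has_integral 0) {0..1}"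
    using has_integral_coefficient_circlepath[of r "\<lambda>_. 2 * A" m] r m
    by (simp add: c_def higher_deriv_const)
  have "((\<lambda>x. 2 * A / c x ^ m - (f (c x) / c x ^ m + cnj (f (c x)) / c x ^ m))
      has_integral 0 - ((deriv ^^ m) f 0 / fact m + 0)) {0..1}"
    by (intro has_integral_diff has_integral_add const coef conj)
  moreover have "2 * A / c x ^ m - (f (c x) / c x ^ m + cnj (f (c x)) / c x ^ m)
      = of_real (2 * A - 2 * Re (f (c x))) / c x ^ m" for x
    by (simp add: complex_add_cnj diff_divide_distrib flip: add_divide_distrib)
  ultimately have int: "((\<lambda>x. of_real (2 * A - 2 * Re (f (c x))) / c x ^ m)
      has_integral - ((deriv ^^ m) f 0 / fact m)) {0..1}"
    by simp
  \<comment> \<open>By the mean value property, the nonnegative numerator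
    \<open>2 * A - 2 * Re f\<close> has an explicit integral.\<close>
  have "((\<lambda>x. f (c x)) has_integral f 0) {0..1}"
    using has_integral_coefficient_circlepath[OF cont holo r, of 0] by (simp add: c_def)
  then have "((\<lambda>x. Re (f (c x))) has_integral Re (f 0)) {0..1}"
    by (rule has_integral_Re)
  then have bound: "((\<lambda>x. (2 * A - 2 * Re (f (c x))) / r ^ m)
      has_integral (2 * A - 2 * Re (f 0)) / r ^ m) {0..1}"
    using has_integral_const_real[of A 0 1]
    by (intro has_integral_divide has_integral_diff has_integral_mult_right) auto
  have "norm (integral {0..1} (\<lambda>x. of_real (2 * A - 2 * Re (f (c x))) / c x ^ m))
      \<le> integral {0..1} (\<lambda>x. (2 * A - 2 * Re (f (c x))) / r ^ m)"
  proof (rule integral_norm_bound_integral)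
    fix x :: real assume "x \<in> {0..1}"
    have "norm (of_real (2 * A - 2 * Re (f (c x))) / c x ^ m) = \<bar>2 * A - 2 * Re (f (c x))\<bar> / r ^ m"
      by (simp only: norm_divide norm_of_real norm_power norm_c)
    then show "norm (of_real (2 * A - 2 * Re (f (c x))) / c x ^ m) \<le> (2 * A - 2 * Re (f (c x))) / r ^ m"
      using Re_le[OF norm_c[of x]] by simp
  qed (use int bound in \<open>auto intro: has_integral_integrable\<close>)
  then show ?thesis
    unfolding integral_unique[OF int] integral_unique[OF bound] by (simp add: norm_minus_cancel)
qed

subsection \<open>Parity identities for the theta series\<close>

lemma has_sum_times:
  fixes f g :: "_ \<Rightarrow> 'a :: {banach, real_normed_field}"
  assumes f: "(\<lambda>x. norm (f x)) summable_on A" "(f has_sum s) A"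
    and g: "(\<lambda>y. norm (g y)) summable_on B" "(g has_sum t) B"
  shows "((\<lambda>(x, y). f x * g y) has_sum s * t) (A \<times> B)"
proof (rule has_sum_SigmaI)
  show "((\<lambda>y. case (x, y) of (x, y) \<Rightarrow> f x * g y) has_sum f x * t) B" for x
    using has_sum_cmult_right[OF g(2)] by simp
  show "((\<lambda>x. f x * t) has_sum s * t) A"
    by (rule has_sum_cmult_left[OF f(2)])
  have "(\<lambda>p. norm (case p of (x, y) \<Rightarrow> f x * g y)) summable_on A \<times> B"
    unfolding Infinite_Sum.abs_summable_on_Sigma_iff
    using summable_on_cmult_right[OF g(1)] summable_on_cmult_left[OF f(1)]
    by (simp add: norm_mult infsum_cmult_right' abs_mult)
  then show "(\<lambda>(x, y). f x * g y) summable_on A \<times> B"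
    by (rule abs_summable_summable)
qed

text \<open>Polymorphic because the complex function is estimated on circles by the real
  one.\<close>

definition theta :: "'a :: {banach, real_normed_field} \<Rightarrow> 'a" where
  "theta q = 1 + 2 * (\<Sum>n. q ^ (Suc n)\<^sup>2)"

lemma power_square_le_power:
  fixes x :: real
  assumes "0 \<le> x" "x < 1"
  shows "x ^ (Suc n)\<^sup>2 \<le> x ^ Suc n"
  using assms by (intro power_decreasing) (auto simp: power2_eq_square)

lemma summable_norm_square_powers:
  fixes q :: "'a :: {banach, real_normed_field}"
  assumes "norm q < 1"
  shows "summable (\<lambda>n. norm (q ^ (Suc n)\<^sup>2))"
proof (rule summable_comparison_test)
  show "\<exists>N. \<forall>n\<ge>N. norm (norm (q ^ (Suc n)\<^sup>2)) \<le> norm q ^ Suc n"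
    using assms power_square_le_power[of "norm q"] by (auto simp: norm_power)
  show "summable (\<lambda>n. norm q ^ Suc n)"
    using assms by (subst summable_Suc_iff) (simp add: summable_geometric)
qed

lemma square_powers_has_sum:
  fixes q :: "'a :: {banach, real_normed_field}"
  assumes "norm q < 1"
  shows "((\<lambda>n. q ^ (Suc n)\<^sup>2) has_sum (\<Sum>n. q ^ (Suc n)\<^sup>2)) UNIV"
  by (rule norm_summable_imp_has_sum[OF _ summable_sums[OF summable_norm_cancel]];
      rule summable_norm_square_powers[OF assms])

text \<open>The two-sided form is what the change of variables on
  \<open>\<int> \<times> \<int>\<close> requires.\<close>

lemma theta_has_sum:
  fixes q :: "'a :: {banach, real_normed_field}"
  assumes "norm q < 1"
  shows "((\<lambda>n::int. q ^ nat (n\<^sup>2)) has_sum theta q) UNIV"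
proof -
  let ?f = "\<lambda>n::int. q ^ nat (n\<^sup>2)"
  define S where "S = (\<Sum>n. q ^ (Suc n)\<^sup>2)"
  have S: "((\<lambda>n. q ^ (Suc n)\<^sup>2) has_sum S) UNIV"
    unfolding S_def by (rule square_powers_has_sum[OF assms])
  have sq: "nat ((1 + int n)\<^sup>2) = (Suc n)\<^sup>2" "nat ((- 1 - int n)\<^sup>2) = (Suc n)\<^sup>2" for n
  proof -
    have "(1 + int n)\<^sup>2 = int ((Suc n)\<^sup>2)" "(- 1 - int n)\<^sup>2 = int ((Suc n)\<^sup>2)"
      by (simp_all add: power2_eq_square algebra_simps)
    then show "nat ((1 + int n)\<^sup>2) = (Suc n)\<^sup>2" "nat ((- 1 - int n)\<^sup>2) = (Suc n)\<^sup>2"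
      by (simp_all only: nat_int)
  qed
  have "(?f has_sum S) {1..} \<longleftrightarrow> ((\<lambda>n. q ^ (Suc n)\<^sup>2) has_sum S) UNIV"
  proof (rule has_sum_reindex_bij_witness[where i = "\<lambda>n. 1 + int n" and j = "\<lambda>k. nat (k - 1)"])
    fix a :: int assume "a \<in> {1..}"
    then show "q ^ (Suc (nat (a - 1)))\<^sup>2 = q ^ nat (a\<^sup>2)"
      using sq(1)[of "nat (a - 1)"] by simp
  qed auto
  moreover have "(?f has_sum S) {..-1} \<longleftrightarrow> ((\<lambda>n. q ^ (Suc n)\<^sup>2) has_sum S) UNIV"
  proof (rule has_sum_reindex_bij_witness[where i = "\<lambda>n. - 1 - int n" and j = "\<lambda>k. nat (- k - 1)"])
    fix a :: int assume "a \<in> {..-1}"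
    then show "q ^ (Suc (nat (- a - 1)))\<^sup>2 = q ^ nat (a\<^sup>2)"
      using sq(2)[of "nat (-a - 1)"] by simp
  qed auto
  moreover have "(?f has_sum 1) {0}"
    by (rule has_sum_finiteI) auto
  ultimately have "(?f has_sum 1 + (S + S)) ({0} \<union> ({1..} \<union> {..-1}))"
    using S by (intro has_sum_Un_disjoint) auto
  also have "{0} \<union> ({1..} \<union> {..-1}) = (UNIV :: int set)"
    by auto
  also have "1 + (S + S) = theta q"
    by (simp only: theta_def S_def mult_2)
  finally show ?thesis .
qed

lemma theta_abs_summable:
  fixes q :: "'a :: {banach, real_normed_field}"
  assumes "norm q < 1"
  shows "(\<lambda>n::int. norm (q ^ nat (n\<^sup>2))) summable_on A"
proof (rule summable_on_subset_banach)
  show "(\<lambda>n::int. norm (q ^ nat (n\<^sup>2))) summable_on UNIV"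
    using has_sum_imp_summable[OF theta_has_sum[of "norm q"]] assms by (simp add: norm_power)
qed simp

text \<open>Since \<open>n\<^sup>2\<close> has the parity of \<open>n\<close>, this and
  \<open>theta_odd\<close> are the even and odd parts of \<open>theta\<close> as a function of
  \<open>q\<close>.\<close>

definition theta_even :: "'a :: {banach, real_normed_field} \<Rightarrow> 'a" where
  "theta_even q = (\<Sum>\<^sub>\<infinity>n\<in>{n::int. even n}. q ^ nat (n\<^sup>2))"

definition theta_odd :: "'a :: {banach, real_normed_field} \<Rightarrow> 'a" where
  "theta_odd q = (\<Sum>\<^sub>\<infinity>n\<in>{n::int. odd n}. q ^ nat (n\<^sup>2))"

lemma
  fixes q :: "'a :: {banach, real_normed_field}"
  assumes "norm q < 1"
  shows theta_even_has_sum: "((\<lambda>n::int. q ^ nat (n\<^sup>2)) has_sum theta_even q) {n. even n}"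
    and theta_odd_has_sum: "((\<lambda>n::int. q ^ nat (n\<^sup>2)) has_sum theta_odd q) {n. odd n}"
  unfolding theta_even_def theta_odd_def
  by (rule has_sum_infsum, rule abs_summable_summable, rule theta_abs_summable[OF assms])+

lemma even_nat_square_iff: "even (nat (n\<^sup>2)) \<longleftrightarrow> even (n::int)"
proof -
  have "even (int (nat (n\<^sup>2))) \<longleftrightarrow> even n"
    by simp
  then show ?thesis
    by (simp only: even_of_nat_iff)
qed

lemma theta_eq_even_plus_odd:
  fixes q :: "'a :: {banach, real_normed_field}"
  assumes "norm q < 1"
  shows "theta q = theta_even q + theta_odd q"
proof -
  have "((\<lambda>n::int. q ^ nat (n\<^sup>2)) has_sum theta_even q + theta_odd q) ({n. even n} \<union> {n. odd n})"
    using assms by (intro has_sum_Un_disjoint theta_even_has_sum theta_odd_has_sum) auto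
  moreover have "{n. even n} \<union> {n. odd n} = (UNIV :: int set)"
    by auto
  ultimately show ?thesis
    using theta_has_sum[OF assms] has_sum_unique by force
qed

lemma theta_even_minus: "theta_even (- q) = theta_even q"
  unfolding theta_even_def by (intro infsum_cong) (simp add: even_nat_square_iff power_minus_even)

lemma theta_odd_minus: "theta_odd (- q) = - theta_odd q"
proof -
  have "theta_odd (- q) = (\<Sum>\<^sub>\<infinity>n\<in>{n::int. odd n}. - (q ^ nat (n\<^sup>2)))"
    unfolding theta_odd_def by (rule infsum_cong) (simp add: even_nat_square_iff power_minus_odd)
  then show ?thesis
    by (simp only: theta_odd_def infsum_uminus)
qed

text \<open>The substitution \<open>a = x + y\<close>, \<open>b = x - y\<close> turns \<open>2 (x\<^sup>2 + y\<^sup>2)\<close> into \<open>a\<^sup>2 + b\<^sup>2\<close> and maps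
  \<open>\<int>\<^sup>2\<close> onto the pairs of equal parity.\<close>

lemma theta_square:
  fixes q \<epsilon> :: "'a :: {banach, real_normed_field}"
  assumes q: "norm q < 1" and \<epsilon>: "\<epsilon> = 1 \<or> \<epsilon> = - 1"
  shows "(theta (\<epsilon> * q\<^sup>2))\<^sup>2 = (theta_even q)\<^sup>2 + \<epsilon> * (theta_odd q)\<^sup>2"
proof -
  let ?f = "\<lambda>z (n::int). z ^ nat (n\<^sup>2) :: 'a"
  let ?E = "{n::int. even n}" and ?O = "{n::int. odd n}"
  \<comment> \<open>The factor is \<open>\<epsilon> ^ (x\<^sup>2 + y\<^sup>2)\<close> in the new
    variables: its exponent has the parity of \<open>x + y = a\<close>.\<close>
  define h where "h = (\<lambda>(a::int, b). (if even a then 1 else \<epsilon>) * (?f q a * ?f q b))"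
  have q2: "norm (\<epsilon> * q\<^sup>2) < 1"
    using q \<epsilon> by (auto simp: norm_mult norm_power power_less_one_iff)
  have "((\<lambda>(a, b). ?f q a * ?f q b) has_sum theta_even q * theta_even q) (?E \<times> ?E)"
    by (rule has_sum_times) (use q in \<open>simp_all add: theta_abs_summable theta_even_has_sum\<close>)
  then have E: "(h has_sum theta_even q * theta_even q) (?E \<times> ?E)"
    by (rule has_sum_cong[THEN iffD1, rotated]) (auto simp: h_def)
  have "((\<lambda>(a, b). ?f q a * ?f q b) has_sum theta_odd q * theta_odd q) (?O \<times> ?O)"
    by (rule has_sum_times) (use q in \<open>simp_all add: theta_abs_summable theta_odd_has_sum\<close>)
  then have "((\<lambda>p. \<epsilon> * (case p of (a, b) \<Rightarrow> ?f q a * ?f q b)) has_sum \<epsilon> * (theta_odd q * theta_odd q)) (?O \<times> ?O)"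
    by (rule has_sum_cmult_right)
  then have O: "(h has_sum \<epsilon> * (theta_odd q * theta_odd q)) (?O \<times> ?O)"
    by (rule has_sum_cong[THEN iffD1, rotated]) (auto simp: h_def)
  have EO: "(h has_sum theta_even q * theta_even q + \<epsilon> * (theta_odd q * theta_odd q)) (?E \<times> ?E \<union> ?O \<times> ?O)"
    by (rule has_sum_Un_disjoint[OF E O]) auto
  have "((\<lambda>(x, y). ?f (\<epsilon> * q\<^sup>2) x * ?f (\<epsilon> * q\<^sup>2) y) has_sum theta (\<epsilon> * q\<^sup>2) * theta (\<epsilon> * q\<^sup>2)) (UNIV \<times> UNIV)"
    by (rule has_sum_times) (use q2 in \<open>simp_all add: theta_abs_summable theta_has_sum\<close>)
  also have "?this \<longleftrightarrow> (h has_sum theta (\<epsilon> * q\<^sup>2) * theta (\<epsilon> * q\<^sup>2)) (?E \<times> ?E \<union> ?O \<times> ?O)"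
  proof (rule has_sum_reindex_bij_witness[where j = "\<lambda>(x, y). (x + y, x - y)"
        and i = "\<lambda>(a, b). ((a + b) div 2, (a - b) div 2)"])
    fix p :: "int \<times> int"
    obtain x y where p: "p = (x, y)" by force
    have "\<epsilon> ^ nat (x\<^sup>2) * \<epsilon> ^ nat (y\<^sup>2) = (if even (x + y) then 1 else \<epsilon>)"
      using \<epsilon> by (auto simp: even_nat_square_iff minus_one_power_iff)
    moreover have "nat (x\<^sup>2) * 2 + nat (y\<^sup>2) * 2 = nat ((x + y)\<^sup>2) + nat ((x - y)\<^sup>2)"
    proof -
      have "int (nat (x\<^sup>2) * 2 + nat (y\<^sup>2) * 2) = int (nat ((x + y)\<^sup>2) + nat ((x - y)\<^sup>2))"
        unfolding of_nat_add of_nat_mult nat_0_le[OF zero_le_power2] of_nat_numeral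
        by (simp add: power2_sum power2_diff)
      then show ?thesis by (simp only: of_nat_eq_iff)
    qed
    then have "(q\<^sup>2) ^ nat (x\<^sup>2) * (q\<^sup>2) ^ nat (y\<^sup>2) = ?f q (x + y) * ?f q (x - y)"
      by (simp only: power_mult[symmetric] power_add[symmetric] mult.commute[of 2])
    ultimately show "h (case p of (x, y) \<Rightarrow> (x + y, x - y)) = (case p of (x, y) \<Rightarrow> ?f (\<epsilon> * q\<^sup>2) x * ?f (\<epsilon> * q\<^sup>2) y)"
      by (simp add: p h_def power_mult_distrib mult_ac flip: power_mult)
  qed (auto elim!: evenE oddE, presburger+)
  finally show ?thesis
    using EO has_sum_unique by (auto simp: power2_eq_square)
qed

lemma theta_mult_theta_minus:
  fixes q :: "'a :: {banach, real_normed_field}"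
  assumes "norm q < 1"
  shows "theta q * theta (- q) = (theta (- q\<^sup>2))\<^sup>2"
proof -
  have "theta q * theta (- q) = (theta_even q + theta_odd q) * (theta_even q - theta_odd q)"
    using theta_eq_even_plus_odd[of q] theta_eq_even_plus_odd[of "- q"] assms
    by (simp add: theta_even_minus theta_odd_minus)
  also have "\<dots> = (theta (- q\<^sup>2))\<^sup>2"
    using theta_square[of q "- 1"] assms by (simp add: algebra_simps power2_eq_square)
  finally show ?thesis .
qed

lemma theta_square_plus_minus:
  fixes q :: "'a :: {banach, real_normed_field}"
  assumes "norm q < 1"
  shows "(theta q)\<^sup>2 + (theta (- q))\<^sup>2 = 2 * (theta (q\<^sup>2))\<^sup>2"
proof -
  have "(theta q)\<^sup>2 + (theta (- q))\<^sup>2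
      = (theta_even q + theta_odd q)\<^sup>2 + (theta_even q - theta_odd q)\<^sup>2"
    using theta_eq_even_plus_odd[of q] theta_eq_even_plus_odd[of "- q"] assms
    by (simp add: theta_even_minus theta_odd_minus)
  also have "\<dots> = 2 * ((theta_even q)\<^sup>2 + (theta_odd q)\<^sup>2)"
    by (simp add: algebra_simps power2_eq_square)
  also have "(theta_even q)\<^sup>2 + (theta_odd q)\<^sup>2 = (theta (q\<^sup>2))\<^sup>2"
    using theta_square[of q 1] assms by simp
  finally show ?thesis .
qed

lemma theta_doubling:
  fixes q :: real
  assumes "norm q < 1"
  shows "(theta q)\<^sup>2 \<le> 2 * (theta (q\<^sup>2))\<^sup>2"
  using theta_square_plus_minus[of q] assms zero_le_power2[of "theta (- q)"] by linarith

section \<open>Elementary size bounds and absence of zeros in the unit disk\<close>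

lemma norm_theta_le:
  fixes q :: "'a :: {banach, real_normed_field}"
  assumes "norm q < 1"
  shows "norm (theta q) \<le> theta (norm q)"
proof -
  have "norm (theta q) \<le> 1 + 2 * norm (\<Sum>n. q ^ (Suc n)\<^sup>2)"
    unfolding theta_def using norm_triangle_ineq[of 1 "2 * (\<Sum>n. q ^ (Suc n)\<^sup>2)"] by (simp add: norm_mult)
  also have "norm (\<Sum>n. q ^ (Suc n)\<^sup>2) \<le> (\<Sum>n. norm (q ^ (Suc n)\<^sup>2))"
    by (rule summable_norm[OF summable_norm_square_powers[OF assms]])
  finally show ?thesis
    by (simp add: theta_def norm_power)
qed

lemma theta_ge_1:
  fixes q :: real
  assumes "0 \<le> q" "q < 1"
  shows "theta q \<ge> 1"
  unfolding theta_def
  using summable_norm_square_powers[of q] assms by (simp add: suminf_nonneg)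

lemma norm_theta_minus_1_le:
  fixes q :: "'a :: {banach, real_normed_field}"
  assumes "norm q < 1"
  shows "norm (theta q - 1) \<le> 2 * (norm q / (1 - norm q))"
proof -
  have "norm (\<Sum>n. q ^ (Suc n)\<^sup>2) \<le> (\<Sum>n. norm (q ^ (Suc n)\<^sup>2))"
    by (rule summable_norm[OF summable_norm_square_powers[OF assms]])
  also have "\<dots> \<le> (\<Sum>n. norm q * norm q ^ n)"
    using assms power_square_le_power[of "norm q"] summable_norm_square_powers[OF assms]
    by (intro suminf_le) (auto simp: norm_power intro!: summable_mult summable_geometric)
  also have "\<dots> = norm q / (1 - norm q)"
    using assms by (simp add: suminf_mult suminf_geometric summable_geometric)
  finally show ?thesis
    by (simp add: theta_def norm_mult)
qed

text \<open>A zero \<open>q\<close> of \<open>theta\<close> would yield the zeros \<open>- q\<^sup>2\<close>, \<open>- q ^ 4\<close>, \<open>- q ^ 8\<close>, ..., which tend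
  to \<open>0\<close>, where \<open>theta\<close> takes the value \<open>1\<close>.\<close>

lemma theta_nonzero:
  fixes q :: "'a :: {banach, real_normed_field}"
  assumes q: "norm q < 1"
  shows "theta q \<noteq> 0"
proof
  assume "theta q = 0"
  have *: "\<exists>z::'a. theta z = 0 \<and> norm z = norm q ^ 2 ^ k" for k
  proof (induction k)
    case 0
    then show ?case using \<open>theta q = 0\<close> by (intro exI[of _ q]) simp
  next
    case (Suc k)
    then obtain z :: 'a where z: "theta z = 0" "norm z = norm q ^ 2 ^ k" by auto
    have "norm z < 1"
      using q by (simp add: z power_less_one_iff)
    then have "theta (- z\<^sup>2) = 0"
      using theta_mult_theta_minus[of z] z by simp
    then show ?case
      by (intro exI[of _ "- z\<^sup>2"]) (simp add: z norm_power power_mult[symmetric] mult.commute)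
  qed
  \<comment> \<open>Below \<open>1/3\<close> the bound \<open>2 * (x / (1 - x))\<close> for the
    distance of \<open>theta\<close> from 1 is less than 1.\<close>
  obtain N where N: "norm q ^ N < 1/3"
    using real_arch_pow_inv[of "1/3" "norm q"] q by auto
  obtain z :: 'a where z: "theta z = 0" "norm z = norm q ^ 2 ^ N"
    using * by blast
  have "norm z \<le> norm q ^ N"
    unfolding z using q by (intro power_decreasing) (auto simp: less_imp_le)
  then have small: "norm z < 1/3" using N by simp
  then have "2 * (norm z / (1 - norm z)) < 1"
    by (simp add: field_simps)
  then show False
    using norm_theta_minus_1_le[of z] small z by simp
qed

subsection \<open>Size of the theta series on the real axis\<close>

text \<open>The tail from \<open>q ^ 9\<close> on is dominated by a geometric series of ratio
  \<open>1/2\<close>, since \<open>(n + 3)\<^sup>2 \<ge> 9 + n\<close>.\<close>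

lemma theta_le_polynomial:
  fixes q :: real
  assumes "0 \<le> q" "q \<le> 1/2"
  shows "theta q \<le> 1 + 2 * (q + q ^ 4 + 2 * q ^ 9)"
proof -
  have s: "summable (\<lambda>n. q ^ (Suc n)\<^sup>2)"
    using summable_norm_square_powers[of q] assms by simp
  have "(\<Sum>n. q ^ (Suc n)\<^sup>2) = (\<Sum>n. q ^ (Suc (n + 2))\<^sup>2) + (\<Sum>n<2. q ^ (Suc n)\<^sup>2)"
    by (rule suminf_split_initial_segment[OF s])
  also have "(\<Sum>n<2. q ^ (Suc n)\<^sup>2) = q + q ^ 4"
    by (simp add: numeral_2_eq_2) (simp add: numeral_eq_Suc)
  also have "(\<Sum>n. q ^ (Suc (n + 2))\<^sup>2) \<le> (\<Sum>n. q ^ 9 * (1/2) ^ n)"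
  proof (rule suminf_le)
    fix n
    have "q ^ (Suc (n + 2))\<^sup>2 \<le> q ^ (9 + n)"
      using assms by (intro power_decreasing) (auto simp: power2_eq_square)
    also have "\<dots> \<le> q ^ 9 * (1/2) ^ n"
      unfolding power_add using assms by (intro mult_left_mono power_mono) auto
    finally show "q ^ (Suc (n + 2))\<^sup>2 \<le> q ^ 9 * (1/2) ^ n" .
  qed (use s summable_iff_shift[of "\<lambda>n. q ^ (Suc n)\<^sup>2" 2] in \<open>auto intro!: summable_mult summable_geometric\<close>)
  also have "\<dots> = 2 * q ^ 9"
    by (simp add: suminf_mult suminf_geometric summable_geometric)
  finally show ?thesis
    by (simp add: theta_def algebra_simps)
qed

text \<open>The polynomial bound at \<open>q = 24 powr (- x)\<close>, written as a positive
  combination of exponentials so that convexity in \<open>x\<close> is visible.\<close>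

definition theta_majorant :: "real \<Rightarrow> real" where
  "theta_majorant x = 1 + 2 * (24 powr (- x) + 24 powr (- (4 * x)) + 2 * 24 powr (- (9 * x)))"

lemma convex_powr_neg:
  fixes b c :: real
  assumes "b > 0"
  shows "convex_on UNIV (\<lambda>x. b powr (- (c * x)))"
proof (rule f''_ge0_imp_convex)
  show "((\<lambda>x. b powr (- (c * x))) has_real_derivative - c * ln b * b powr (- (c * x))) (at x)" for x
    using assms by (auto simp: powr_def intro!: derivative_eq_intros)
  show "((\<lambda>x. - c * ln b * b powr (- (c * x))) has_real_derivative (c * ln b)\<^sup>2 * b powr (- (c * x))) (at x)" for x
    using assms by (auto simp: powr_def power2_eq_square intro!: derivative_eq_intros)
qed auto

lemma convex_theta_majorant: "convex_on UNIV theta_majorant"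
proof -
  have "convex_on UNIV (\<lambda>x. 1 + 2 * (24 powr (- (1 * x)) + 24 powr (- (4 * x)) + 2 * 24 powr (- (9 * x))) :: real)"
    by (intro convex_on_add convex_on_cmul convex_powr_neg) (auto simp: convex_on_const)
  then show ?thesis
    by (simp add: theta_majorant_def[abs_def])
qed

text \<open>The left side is the tangent at \<open>1 / k\<^sup>2\<close>, so rational
  \<open>k\<close> gives rational coefficients. With \<open>s = sqrt x\<close> the claim is
  \<open>(k * s - 1)\<^sup>2 * (k * s + 2) \<ge> 0\<close>.\<close>

lemma tangent_le_powr_neg_half:
  fixes x k :: real
  assumes "x > 0" "k > 0"
  shows "k * (3 - k\<^sup>2 * x) / 2 \<le> x powr (- (1/2))"
proof -
  define s where "s = sqrt x"
  have s: "s > 0" "x = s\<^sup>2" using assms by (auto simp: s_def)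
  have "0 \<le> (k * s - 1)\<^sup>2 * (k * s + 2)"
    using assms s by (intro mult_nonneg_nonneg) auto
  then have "k * (3 - k\<^sup>2 * x) / 2 * s \<le> 1"
    unfolding s(2) by (simp add: algebra_simps power2_eq_square)
  then have "k * (3 - k\<^sup>2 * x) / 2 \<le> 1 / s"
    using s by (simp add: pos_le_divide_eq)
  also have "\<dots> = x powr (- (1/2))"
    using assms by (simp add: powr_minus powr_half_sqrt s_def inverse_eq_divide)
  finally show ?thesis .
qed

text \<open>The majorant is convex and the tangent at \<open>1 / k\<^sup>2\<close> of the convex function \<open>x powr (- (1/2))\<close>
  is affine, so comparing them at the end points suffices.\<close>

lemma theta_majorant_le_on_interval:
  fixes a b k x :: real
  assumes "0 < a" "a \<le> x" "x \<le> b" "k > 0"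
    and a: "theta_majorant a \<le> k * (3 - k\<^sup>2 * a) / 2"
    and b: "theta_majorant b \<le> k * (3 - k\<^sup>2 * b) / 2"
  shows "theta_majorant x \<le> x powr (- (1/2))"
proof -
  have "x \<in> closed_segment a b"
    using assms by (auto simp: closed_segment_eq_real_ivl)
  then obtain t where t: "0 \<le> t" "t \<le> 1" "x = (1 - t) * a + t * b"
    by (auto simp: in_segment)
  have "theta_majorant x \<le> (1 - t) * theta_majorant a + t * theta_majorant b"
    using convex_onD[OF convex_theta_majorant t(1,2), of a b] t(3) by simp
  also have "\<dots> \<le> (1 - t) * (k * (3 - k\<^sup>2 * a) / 2) + t * (k * (3 - k\<^sup>2 * b) / 2)"
    using a b t by (intro add_mono mult_left_mono) auto
  also have "\<dots> = k * (3 - k\<^sup>2 * x) / 2"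
    unfolding t(3) by (simp add: field_simps)
  also have "\<dots> \<le> x powr (- (1/2))"
    using assms by (intro tangent_le_powr_neg_half) auto
  finally show ?thesis .
qed

text \<open>The fraction \<open>41/50\<close> slightly exceeds \<open>24 powr (- (1/16))\<close>, so
  end point values at multiples of \<open>1/16\<close> reduce to rational arithmetic.\<close>

lemma theta_majorant_sixteenths_le:
  "theta_majorant (real j / 16) \<le> 1 + 2 * ((41/50) ^ j + (41/50) ^ (4 * j) + 2 * (41/50) ^ (9 * j))"
proof -
  have "(1/24 :: real) \<le> (41/50) ^ 16"
    by (simp add: power_divide)
  then have "(1/24 :: real) powr (1/16) \<le> ((41/50) ^ 16) powr (1/16)"
    by (intro powr_mono2) auto
  also have "\<dots> = 41/50"
    by (simp add: powr_realpow[symmetric] powr_powr del: powr_numeral)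
  finally have p: "(1/24 :: real) powr (1/16) \<le> 41/50" .
  have "24 powr (- (c * (real j / 16))) \<le> (41/50) ^ n" if "real n = c * real j" for c :: real and n
  proof -
    have "24 powr (- (c * (real j / 16))) = ((1/24 :: real) powr (1/16)) powr real n"
      unfolding powr_powr that by (simp add: powr_divide powr_minus_divide)
    also have "\<dots> = ((1/24 :: real) powr (1/16)) ^ n"
      by (rule powr_realpow) simp
    also have "\<dots> \<le> (41/50) ^ n"
      by (intro power_mono p) simp
    finally show ?thesis .
  qed
  from this[of j 1] this[of "4 * j" 4] this[of "9 * j" 9] show ?thesis
    by (simp add: theta_majorant_def)
qed

lemma theta_le_quarter_half:
  fixes x :: real
  assumes "1/4 \<le> x" "x \<le> 1/2"
  shows "theta (24 powr (- x)) \<le> x powr (- (1/2))"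
proof -
  \<comment> \<open>This secures the hypothesis \<open>q \<le> 1/2\<close> of
    \<open>theta_le_polynomial\<close>.\<close>
  have "24 powr (- x) \<le> (16 powr (- (1/4)) :: real)"
  proof -
    have "24 powr (- x) \<le> 24 powr (- (1/4) :: real)"
      using assms by (intro powr_mono) auto
    also have "\<dots> \<le> 16 powr (- (1/4))"
      by (intro powr_mono2') auto
    finally show ?thesis .
  qed
  also have "16 powr (- (1/4)) = (1/2 :: real)"
  proof -
    have "(16::real) powr (- (1/4)) = (2 powr 4) powr (- (1/4))"
      by simp
    also have "\<dots> = 1/2"
      by (subst powr_powr) (simp add: powr_minus)
    finally show ?thesis .
  qed
  finally have "theta (24 powr (- x)) \<le> theta_majorant x"
    using theta_le_polynomial[of "24 powr (- x)"]
    by (simp add: theta_majorant_def powr_power mult.commute)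
  also have "\<dots> \<le> x powr (- (1/2))"
  proof -
    have piece: ?thesis
      if "real j / 16 \<le> x" "x \<le> real (Suc j) / 16" "0 < j" "k > 0"
        "1 + 2 * ((41/50) ^ j + (41/50) ^ (4 * j) + 2 * (41/50) ^ (9 * j)) \<le> k * (3 - k\<^sup>2 * (real j / 16)) / 2"
        "1 + 2 * ((41/50) ^ Suc j + (41/50) ^ (4 * Suc j) + 2 * (41/50) ^ (9 * Suc j))
          \<le> k * (3 - k\<^sup>2 * (real (Suc j) / 16)) / 2" for j and k :: real
      by (rule theta_majorant_le_on_interval[of "real j / 16" _ "real (Suc j) / 16" k])
         (use that theta_majorant_sixteenths_le[of j] theta_majorant_sixteenths_le[of "Suc j"] in auto)
    \<comment> \<open>Each \<open>k\<close> below places the point of tangency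
      \<open>1 / k\<^sup>2\<close> inside its interval of length \<open>1/16\<close>.\<close>
    consider "x \<le> 5/16" | "5/16 \<le> x" "x \<le> 6/16" | "6/16 \<le> x" "x \<le> 7/16" | "7/16 \<le> x"
      by linarith
    then show ?thesis
    proof cases
      case 1
      then show ?thesis using assms by (intro piece[of 4 "189/100"]) (simp_all add: power_divide)
    next
      case 2
      then show ?thesis by (intro piece[of 5 "169/100"]) (simp_all add: power_divide)
    next
      case 3
      then show ?thesis by (intro piece[of 6 "154/100"]) (simp_all add: power_divide)
    next
      case 4
      then show ?thesis using assms by (intro piece[of 7 "144/100"]) (simp_all add: power_divide)
    qed
  qed
  finally show ?thesis .
qed

text \<open>By \<open>theta_doubling\<close>, \<open>sqrt x * theta (24 powr (- x))\<close> does not decrease when \<open>x\<close> is doubled.\<close>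

lemma theta_le_powr_neg_half:
  fixes x :: real
  assumes "0 < x" "x \<le> 1/2"
  shows "theta (24 powr (- x)) \<le> x powr (- (1/2))"
proof -
  have *: "theta (24 powr (- x)) \<le> x powr (- (1/2))" if "1 / 2 ^ (k + 2) \<le> x" "x \<le> 1/2" for k and x :: real
    using that
  proof (induction k arbitrary: x)
    case 0
    then show ?case by (intro theta_le_quarter_half) auto
  next
    case (Suc k)
    show ?case
    proof (cases "x \<le> 1/4")
      case False
      then show ?thesis using Suc.prems by (intro theta_le_quarter_half) auto
    next
      case True
      have "0 < 1 / (2::real) ^ (Suc k + 2)" by simp
      then have x: "x > 0" using Suc.prems(1) by linarith
      then have q: "0 \<le> 24 powr (- x)" "24 powr (- x) < (1::real)"
        by (auto simp: powr_less_one)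
      have "(theta (24 powr (- x)))\<^sup>2 \<le> 2 * (theta ((24 powr (- x))\<^sup>2))\<^sup>2"
        using q by (intro theta_doubling) auto
      also have "(24 powr (- x))\<^sup>2 = (24 powr (- (2 * x)) :: real)"
        by (simp add: powr_power)
      also have "2 * (theta (24 powr (- (2 * x)) :: real))\<^sup>2 \<le> 2 * ((2 * x) powr (- (1/2)))\<^sup>2"
        using Suc.IH[of "2 * x"] Suc.prems True x theta_ge_1[of "24 powr (- (2 * x))"]
        by (intro mult_left_mono power_mono) (auto simp: powr_less_one field_simps)
      \<comment> \<open>The factor 2 from doubling is exactly the loss in \<open>1 / (2 * x)\<close>
        against \<open>1 / x\<close>.\<close>
      also have "\<dots> = (x powr (- (1/2)))\<^sup>2"
        using x by (simp add: powr_power powr_minus field_simps)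
      finally show ?thesis
        by (rule power2_le_imp_le) simp
    qed
  qed
  obtain k where k: "(1/2) ^ k < 4 * x"
    using real_arch_pow_inv[of "4 * x" "1/2"] assms by auto
  show ?thesis
    by (rule *[of k]) (use k assms in \<open>simp_all add: power_divide field_simps\<close>)
qed

subsection \<open>Powers of the theta series\<close>

text \<open>Links the formal series, whose coefficients are the indicator of the squares, to the
  analytic one by reindexing along the injective map
  \<open>n \<mapsto> (Suc n)\<^sup>2\<close>.\<close>

lemma squares_fps_nth_sums:
  assumes "norm z < 1"
  shows "(\<lambda>m. fps_nth squares_fps m * z ^ m) sums (\<Sum>n. z ^ (Suc n)\<^sup>2)"
proof -
  let ?g = "\<lambda>m. fps_nth squares_fps m * z ^ m" and ?sq = "\<lambda>n. (Suc n)\<^sup>2"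
  have inj: "inj ?sq"
    by (rule injI) (simp add: power2_eq_iff_nonneg)
  have nth: "fps_nth squares_fps m = (if m \<in> range ?sq then 1 else 0)" for m
    unfolding squares_fps_def by (auto simp: image_iff) (metis Suc_le_D)
  have "((\<lambda>n. z ^ (Suc n)\<^sup>2) has_sum (\<Sum>n. z ^ (Suc n)\<^sup>2)) UNIV"
    by (rule square_powers_has_sum[OF assms])
  then have "((\<lambda>m. z ^ m) has_sum (\<Sum>n. z ^ (Suc n)\<^sup>2)) (range ?sq)"
    by (subst has_sum_reindex[OF inj]) (simp add: o_def)
  also have "?this \<longleftrightarrow> (?g has_sum (\<Sum>n. z ^ (Suc n)\<^sup>2)) UNIV"
    by (rule has_sum_cong_neutral) (auto simp: nth)
  finally show ?thesis
    by (rule has_sum_imp_sums)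
qed

lemma fps_conv_radius_squares_fps: "fps_conv_radius squares_fps \<ge> 1"
  unfolding fps_conv_radius_def
proof (rule conv_radius_geI_ex')
  fix r :: real assume "0 < r" "ereal r < 1"
  then show "summable (\<lambda>n. fps_nth squares_fps n * of_real r ^ n)"
    using squares_fps_nth_sums[of "of_real r"] by (auto simp: sums_iff)
qed

lemma theta_eq_eval_fps:
  assumes "norm z < 1"
  shows "theta z = 1 + 2 * eval_fps squares_fps z"
  using squares_fps_nth_sums[OF assms] by (simp add: theta_def eval_fps_def sums_iff)

lemma holomorphic_on_theta: "(theta :: complex \<Rightarrow> complex) holomorphic_on ball 0 1"
proof -
  have "ball 0 1 \<subseteq> eball 0 (fps_conv_radius (squares_fps :: complex fps))"
    using fps_conv_radius_squares_fps by (intro ball_eball_mono) (simp add: one_ereal_def)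
  then have "(\<lambda>z. 1 + 2 * eval_fps squares_fps z) holomorphic_on ball 0 1"
    by (intro holomorphic_intros)
  then show ?thesis
    by (rule holomorphic_transform) (simp add: theta_eq_eval_fps)
qed

lemma theta_minus_1_has_fps_expansion: "(\<lambda>z. theta z - 1) has_fps_expansion 2 * squares_fps"
proof -
  have "eval_fps squares_fps has_fps_expansion squares_fps"
    using fps_conv_radius_squares_fps
    by (intro eval_fps_has_fps_expansion) (auto intro: less_le_trans[of 0 1])
  then have "(\<lambda>z. 2 * eval_fps squares_fps z) has_fps_expansion 2 * squares_fps"
    by (intro fps_expansion_intros)
  moreover have "eventually (\<lambda>z::complex. z \<in> ball 0 1) (nhds 0)"
    by (intro eventually_nhds_in_open) auto
  then have "eventually (\<lambda>z. 2 * eval_fps squares_fps z = theta z - 1) (nhds 0)"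
    by eventually_elim (simp add: theta_eq_eval_fps)
  ultimately show ?thesis
    by (rule has_fps_expansion_cong[THEN iffD1, OF _ refl, rotated])
qed

lemma theta_0: "theta 0 = 1"
  by (simp add: theta_def zero_power)

text \<open>A holomorphic logarithm of the zero-free \<open>theta\<close> defines the power on the
  whole disk without a branch cut. Near 0 it agrees with the principal power, whose expansion is the
  binomial series; the modulus formula uses that \<open>u\<close> is real.\<close>

lemma theta_power_holomorphic:
  fixes u :: real
  obtains h where "h holomorphic_on ball 0 1" "h has_fps_expansion theta_power_fps (of_real u)"
    "h 0 = 1" "\<forall>z\<in>ball 0 1. norm (h z) = norm (theta z) powr u"
proof -
  obtain g where g: "g holomorphic_on ball 0 1" "\<And>z. z \<in> ball 0 1 \<Longrightarrow> theta z = exp (g z)"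
    by (rule contractible_imp_holomorphic_log[OF holomorphic_on_theta])
       (auto intro: convex_imp_contractible simp: theta_nonzero)
  \<comment> \<open>Still a logarithm, because \<open>exp (g 0) = theta 0 = 1\<close>. Now
    \<open>L 0 = 0\<close>, so \<open>Im (L z)\<close> lies between \<open>- pi\<close> and
    \<open>pi\<close> near 0 and \<open>L\<close> is \<open>Ln (theta z)\<close> there.\<close>
  define L where "L = (\<lambda>z. g z - g 0)"
  have L: "L holomorphic_on ball 0 1"
    unfolding L_def by (intro holomorphic_intros g)
  have exp_L: "theta z = exp (L z)" if "norm z < 1" for z
    using g(2)[of z] g(2)[of 0] that by (simp add: L_def exp_diff theta_0)
  define h where "h = (\<lambda>z. exp (of_real u * L z))"
  have "isCont L 0"
    using L holomorphic_on_imp_continuous_on[of L "ball 0 1"] by (simp add: continuous_on_eq_continuous_at)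
  then have "((\<lambda>z. Im (L z)) \<longlongrightarrow> Im (L 0)) (nhds 0)"
    by (intro tendsto_Im) (simp add: isCont_def tendsto_at_iff_tendsto_nhds)
  then have "eventually (\<lambda>z. - pi < Im (L z)) (nhds 0)" "eventually (\<lambda>z. Im (L z) < pi) (nhds 0)"
    by (auto intro!: order_tendstoD simp: L_def)
  moreover have "eventually (\<lambda>z::complex. z \<in> ball 0 1) (nhds 0)"
    by (intro eventually_nhds_in_open) auto
  ultimately have ev: "eventually (\<lambda>z. ((\<lambda>x. (1 + x) powr of_real u) \<circ> (\<lambda>z. theta z - 1)) z = h z) (nhds 0)"
  proof eventually_elim
    case (elim z)
    then have "Ln (theta z) = L z" "theta z \<noteq> 0"
      using exp_L[of z] by (auto simp: Ln_exp)
    then show ?case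
      by (simp add: h_def powr_def)
  qed
  have "h holomorphic_on ball 0 1"
    unfolding h_def by (intro holomorphic_intros L)
  moreover have "((\<lambda>x. (1 + x) powr of_real u) \<circ> (\<lambda>z. theta z - 1)) has_fps_expansion theta_power_fps (of_real u)"
    unfolding theta_power_fps_def
    by (intro has_fps_expansion_compose has_fps_expansion_binomial_complex theta_minus_1_has_fps_expansion)
       (simp add: squares_fps_def)
  then have "h has_fps_expansion theta_power_fps (of_real u)"
    by (rule has_fps_expansion_cong[THEN iffD1, OF ev refl])
  moreover have "h 0 = 1"
    by (simp add: h_def L_def)
  moreover have "\<forall>z\<in>ball 0 1. norm (h z) = norm (theta z) powr u"
    by (simp add: exp_L h_def powr_def)
  ultimately show ?thesis
    by (rule that)
qed

text \<open>On the circle of radius \<open>r\<close> the power \<open>h\<close> is bounded by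
  \<open>theta r powr u\<close>. Cauchy's inequality gives the first bound; the real part bound with
  \<open>h 0 = 1\<close> gives the second, which vanishes at \<open>u = 0\<close>.\<close>

lemma
  fixes u r :: real
  assumes u: "u \<ge> 0" and r: "0 < r" "r < 1"
  shows norm_theta_coeff_le: "norm (theta_coeff (of_real u) m) \<le> theta r powr u / r ^ m"
    and norm_theta_coeff_le_diff:
      "m > 0 \<Longrightarrow> norm (theta_coeff (of_real u) m) \<le> 2 * (theta r powr u - 1) / r ^ m"
proof -
  obtain h where h: "h holomorphic_on ball 0 1" "h has_fps_expansion theta_power_fps (of_real u)"
    "h 0 = 1" "\<forall>z\<in>ball 0 1. norm (h z) = norm (theta z) powr u"
    by (rule theta_power_holomorphic[of u])
  have coeff: "theta_coeff (of_real u) m = (deriv ^^ m) h 0 / fact m"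
    unfolding theta_coeff_def by (rule fps_nth_fps_expansion[OF h(2)])
  have cont: "continuous_on (cball 0 r) h"
    by (rule continuous_on_subset[OF holomorphic_on_imp_continuous_on[OF h(1)]]) (use r in auto)
  have holo: "h holomorphic_on ball 0 r"
    by (rule holomorphic_on_subset[OF h(1)]) (use r in auto)
  have h_le: "norm (h z) \<le> theta r powr u" if "norm z = r" for z
    using h(4)[rule_format, of z] norm_theta_le[of z] that r u by (simp add: powr_mono2)
  have "norm ((deriv ^^ m) h 0) \<le> fact m * (theta r powr u) / r ^ m"
    by (rule Cauchy_inequality[OF holo cont r(1)]) (simp add: h_le)
  then show "norm (theta_coeff (of_real u) m) \<le> theta r powr u / r ^ m"
    by (simp add: coeff norm_divide field_simps)
  assume m: "m > 0"
  have "norm ((deriv ^^ m) h 0 / fact m) \<le> 2 * (theta r powr u - Re (h 0)) / r ^ m"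
    by (rule norm_coefficient_le_of_Re_le[OF cont holo r(1) _ m])
       (use h_le complex_Re_le_cmod order_trans in blast)
  then show "norm (theta_coeff (of_real u) m) \<le> 2 * (theta r powr u - 1) / r ^ m"
    by (simp add: coeff h(3))
qed

section \<open>Explicit first coefficients and the two final estimates\<close>

lemma theta_coeff_1: "theta_coeff w (Suc 0) = 2 * w"
proof -
  have "fps_nth squares_fps 1 = 1"
    by (auto simp: squares_fps_def)
  then show ?thesis
    by (simp add: theta_coeff_def theta_power_fps_def fps_compose_nth numeral_fps_const)
qed

lemma theta_coeff_2: "theta_coeff w 2 = 2 * w * (w - 1)"
proof -
  have "\<not> (\<exists>n\<ge>1. 2 = (n::nat) ^ 2)"
  proof
    assume "\<exists>n\<ge>1. 2 = (n::nat) ^ 2"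
    then obtain n :: nat where n: "2 = n\<^sup>2" by blast
    then have "n < 2" by (intro power2_less_imp_less[of n 2]) auto
    with n show False by (auto simp: less_2_cases_iff)
  qed
  then have S: "fps_nth squares_fps 0 = 0" "fps_nth squares_fps 1 = 1" "fps_nth squares_fps 2 = 0"
    by (auto simp: squares_fps_def)
  have "theta_coeff w 2 = (\<Sum>i=0..2. (w gchoose i) * fps_nth ((2 * squares_fps) ^ i) 2)"
    by (simp add: theta_coeff_def theta_power_fps_def fps_compose_nth)
  \<comment> \<open>Only \<open>i = 2\<close> survives: the term \<open>i = 1\<close> vanishes
    because 2 is not a square.\<close>
  also have "\<dots> = (w gchoose 2) * 4"
    by (simp add: eval_nat_numeral S[simplified] S(3)[unfolded numeral_2_eq_2] power2_eq_square numeral_fps_const fps_mult_nth)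
  also have "\<dots> = 2 * w * (w - 1)"
    by (simp add: gbinomial_prod_rev eval_nat_numeral)
  finally show ?thesis .
qed

text \<open>The radius makes \<open>1 / r ^ m\<close> equal to 24; then
  \<open>x = 1 / m \<le> 1/2\<close> gives \<open>theta r \<le> sqrt m\<close>.\<close>

lemma norm_theta_coeff_le_24:
  fixes u :: real
  assumes u: "u \<ge> 0" and m: "m \<ge> 2"
  shows "norm (theta_coeff (of_real u) m) \<le> 24 * real m powr (u / 2)"
proof -
  define r :: real where "r = 24 powr (- (1 / real m))"
  have r: "0 < r" "r < 1"
    using m by (auto simp: r_def powr_less_one)
  have rm: "r ^ m = 1 / 24"
  proof -
    have "r ^ m = 24 powr (- (1 / real m) * real m)"
      unfolding r_def by (simp add: powr_powr flip: powr_realpow)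
    also have "\<dots> = 1 / 24"
      using m by (simp add: powr_minus_divide)
    finally show ?thesis .
  qed
  have "theta r \<le> (1 / real m) powr (- (1/2))"
    unfolding r_def using m by (intro theta_le_powr_neg_half) auto
  also have "\<dots> = real m powr (1/2)"
    using m by (simp add: powr_divide powr_minus_divide)
  finally have "theta r powr u \<le> (real m powr (1/2)) powr u"
    using u theta_ge_1[of r] r by (intro powr_mono2) auto
  also have "\<dots> = real m powr (u / 2)"
    by (simp add: powr_powr)
  finally show ?thesis
    using norm_theta_coeff_le[OF u r, of m] by (simp add: rm)
qed

text \<open>The tangent to \<open>ln\<close> at \<open>exp 1\<close> passes through the origin; a
  rational \<open>a\<close> below \<open>exp 1\<close> keeps the bound computable.\<close>

lemma ln_le_of_le_exp_1:
  fixes x a :: real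
  assumes "x > 0" "0 < a" "a \<le> exp 1"
  shows "ln x \<le> x / a"
proof -
  have "ln (x / exp 1) \<le> x / exp 1 - 1"
    using assms by (intro ln_le_minus_one) auto
  then have "ln x \<le> x / exp 1"
    using assms by (simp add: ln_div)
  also have "\<dots> \<le> x / a"
    using assms by (intro divide_left_mono) auto
  finally show ?thesis .
qed

text \<open>The radius \<open>24 powr (- (1 / (2 * m)))\<close> keeps the constant below 6; \<open>u * m \<le> 4\<close> bounds the loss
  \<open>2 powr (u / 2)\<close> coming from \<open>theta r \<le> sqrt (2 * m)\<close>.\<close>

lemma norm_theta_coeff_le_small:
  fixes u :: real
  assumes u: "u \<ge> 0" and m: "m \<ge> 3" and um: "u * m \<le> 4"
  shows "norm (theta_coeff (of_real u) m) \<le> 6 * u * real m powr (u / 2 + 1)"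
proof -
  define r :: real where "r = 24 powr (- (1 / (2 * real m)))"
  have r: "0 < r" "r < 1"
    using m by (auto simp: r_def powr_less_one)
  have rm: "1 / r ^ m = sqrt 24"
  proof -
    have "r ^ m = 24 powr (- (1 / (2 * real m)) * real m)"
      unfolding r_def by (simp add: powr_powr flip: powr_realpow)
    also have "\<dots> = 1 / sqrt 24"
      using m by (simp add: powr_minus_divide powr_half_sqrt)
    finally show ?thesis by simp
  qed
  have sqrt24: "sqrt 24 \<le> 49/10"
    by (rule real_le_lsqrt) (simp_all add: power_divide)
  define T where "T = theta r"
  have T1: "T \<ge> 1"
    unfolding T_def using r by (intro theta_ge_1) auto
  have "T \<le> (1 / (2 * real m)) powr (- (1/2))"
    unfolding r_def T_def using m by (intro theta_le_powr_neg_half) auto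
  also have "\<dots> = (2 * real m) powr (1/2)"
    using m by (simp add: powr_divide powr_minus_divide)
  finally have T: "T \<le> (2 * real m) powr (1/2)" .
  have ln: "ln T \<le> real m / (264/100)"
  proof -
    have "ln T \<le> ln ((2 * real m) powr (1/2))"
      using T T1 m by (subst ln_le_cancel_iff) auto
    also have "\<dots> = ln (2 * real m) / 2"
      using m by (simp add: ln_powr)
    also have "ln (2 * real m) \<le> 2 * real m / (264/100)"
    proof (rule ln_le_of_le_exp_1)
      \<comment> \<open>Squaring the quadratic Taylor bound at \<open>1/2\<close> gives about 2.6406
        as a lower bound for \<open>exp 1\<close>.\<close>
      have "(264/100 :: real) \<le> (1 + 1/2 + (1/2)\<^sup>2 / 2)\<^sup>2"
        by (simp add: power2_eq_square)
      also have "\<dots> \<le> (exp (1/2))\<^sup>2"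
        by (intro power_mono exp_lower_Taylor_quadratic) auto
      also have "\<dots> = exp 1"
        by (simp flip: exp_double)
      finally show "264/100 \<le> exp (1::real)" .
    qed (use m in auto)
    finally show ?thesis by simp
  qed
  \<comment> \<open>From \<open>m \<ge> 3\<close> and \<open>u * m \<le> 4\<close> follows
    \<open>u \<le> 4/3\<close>. The decimal bound below is checked by cubing:
    \<open>1.5875 ^ 3\<close> slightly exceeds 4.\<close>
  have "2 powr (u / 2) \<le> (2 :: real) powr (2/3)"
  proof (intro powr_mono)
    have "u * 3 \<le> u * m"
      using u m by (intro mult_left_mono) auto
    then show "u / 2 \<le> 2 / 3" using um by simp
  qed auto
  also have "\<dots> \<le> 15875/10000"
  proof (rule power_le_imp_le_base)
    show "((2::real) powr (2/3)) ^ Suc 2 \<le> (15875/10000) ^ Suc 2"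
      by (simp add: powr_power power_divide)
  qed simp
  finally have two: "2 powr (u / 2) \<le> (15875/10000 :: real)" .
  have "T powr u \<le> ((2 * real m) powr (1/2)) powr u"
    using u T T1 by (intro powr_mono2) auto
  also have "\<dots> = 2 powr (u / 2) * real m powr (u / 2)"
    by (simp add: powr_powr powr_mult)
  also have "\<dots> \<le> 15875/10000 * real m powr (u / 2)"
    using two by (intro mult_right_mono) auto
  finally have Tu: "T powr u \<le> 15875/10000 * real m powr (u / 2)" .
  \<comment> \<open>Multiplying by \<open>T powr u = exp (u * ln T)\<close> bounds
    \<open>T powr u - 1\<close> by a multiple of \<open>u\<close>.\<close>
  have "1 - u * ln T \<le> exp (- (u * ln T))"
    using exp_ge_add_one_self[of "- (u * ln T)"] by simp
  then have "T powr u - 1 \<le> u * ln T * T powr u"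
    using T1 by (simp add: powr_def exp_minus field_simps)
  also have "\<dots> \<le> u * (real m / (264/100)) * (15875/10000 * real m powr (u / 2))"
    using u T1 ln Tu by (intro mult_mono mult_left_mono) auto
  finally have diff: "T powr u - 1 \<le> u * (real m / (264/100)) * (15875/10000 * real m powr (u / 2))" .
  have "norm (theta_coeff (of_real u) m) \<le> 2 * (T powr u - 1) * (1 / r ^ m)"
    unfolding T_def using norm_theta_coeff_le_diff[OF u r, of m] m by simp
  also have "\<dots> \<le> 2 * (u * (real m / (264/100)) * (15875/10000 * real m powr (u / 2))) * (49/10)"
    unfolding rm using diff sqrt24 u T1 by (intro mult_mono mult_left_mono) (auto simp: ge_one_powr_ge_zero)
  also have "\<dots> = (2 * 15875 * 49 / (264 * 1000)) * (u * (real m * real m powr (u / 2)))"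
    by simp
  \<comment> \<open>The accumulated constant is about 5.893.\<close>
  also have "\<dots> \<le> 6 * (u * (real m * real m powr (u / 2)))"
    using u by (intro mult_right_mono) auto
  also have "\<dots> = 6 * u * real m powr (u / 2 + 1)"
    using m by (simp add: powr_add)
  finally show ?thesis .
qed

theorem theorem3p3:
  fixes u :: real
  assumes "u \<ge> 0"
  shows "(\<forall>m::nat. m \<ge> 2 \<longrightarrow>
            norm (theta_coeff (complex_of_real u) m) \<le> 24 * real m powr (u / 2)) \<and>
         (\<forall>m::nat. m \<ge> 1 \<longrightarrow>
            norm (theta_coeff (complex_of_real u) m) \<le> 6 * u * real m powr (u / 2 + 1))"
proof (intro conjI allI impI)
  fix m :: nat assume "m \<ge> 2"
  then show "norm (theta_coeff (complex_of_real u) m) \<le> 24 * real m powr (u / 2)"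
    by (rule norm_theta_coeff_le_24[OF assms])
next
  fix m :: nat assume "m \<ge> 1"
  \<comment> \<open>If \<open>u * m \<ge> 4\<close>, then \<open>24 \<le> 6 * u * m\<close> and (i)
    suffices. For smaller products, \<open>m = 2\<close> is treated by its explicit coefficient,
    since the \<open>2 powr (2/3)\<close> bound needs \<open>m \<ge> 3\<close>.\<close>
  then consider "m = 1" | "m \<ge> 2" "u * m \<ge> 4" | "m = 2" "u \<le> 2" | "m \<ge> 3" "u * m \<le> 4"
  proof -
    consider "m = 1" | "m = 2" | "m \<ge> 3"
      using \<open>m \<ge> 1\<close> by linarith
    then show thesis
      using that linorder_linear[of "u * m" 4] by cases auto
  qed
  then show "norm (theta_coeff (complex_of_real u) m) \<le> 6 * u * real m powr (u / 2 + 1)"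
  proof cases
    case 1
    then show ?thesis using assms by (simp add: theta_coeff_1 norm_mult)
  next
    case 2
    have "norm (theta_coeff (complex_of_real u) m) \<le> 24 * real m powr (u / 2)"
      using norm_theta_coeff_le_24[OF assms] 2 by blast
    also have "\<dots> \<le> 6 * (u * m) * real m powr (u / 2)"
      using 2 by (intro mult_right_mono) auto
    also have "\<dots> = 6 * u * real m powr (u / 2 + 1)"
      using 2 by (simp add: powr_add)
    finally show ?thesis .
  next
    case 3
    have "theta_coeff (complex_of_real u) m = of_real (2 * u * (u - 1))"
      using 3 by (simp add: theta_coeff_2)
    then have "norm (theta_coeff (complex_of_real u) m) = 2 * u * \<bar>u - 1\<bar>"
      using assms by (simp only: norm_of_real) (simp add: abs_mult)
    \<comment> \<open>Here \<open>0 \<le> u \<le> 2\<close>, so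
      \<open>\<bar>u - 1\<bar> \<le> 1\<close>.\<close>
    also have "\<dots> \<le> 2 * u * 1"
      using assms 3 by (intro mult_left_mono) auto
    also have "\<dots> \<le> 6 * u * real m powr (u / 2 + 1)"
      using assms 3 ge_one_powr_ge_zero[of 2 "u / 2 + 1"] by (intro mult_mono) auto
    finally show ?thesis .
  next
    case 4
    then show ?thesis using norm_theta_coeff_le_small[OF assms] by blast
  qed
qed

end
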